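(* For any weighted composition operator $C_{w,f}$ on $L^p(\mu)$, \[ N_p(C_{w,f}) = \sup_{0 < \mu(B) < \infty}\ \sup_{N \in \mathbb{N}} \frac{1}{N} \sum_{n=1}^N \frac{\mu_n(f^{-n}(B))}{\mu(B)}, \] where the first supremum is taken over all measurable sets $B$ with $0 < \mu(B) < \infty$. In particular, $C_{w,f}$ is $p$-absolutely Cesàro bounded if and only if there exists a constant $C \in (0,\infty)$ such that, for each measurable set $B$ of finite positive $\mu$-measure, \[ \frac{1}{N} \sum_{n=1}^N \mu_n(f^{-n}(B)) \le C\, \mu(B) \quad \text{for all } N \in \mathbb{N}. \]
   Context: Fix $\mathbb{K} = \mathbb{R}$ or $\mathbb{C}$, a real number $p \in [1,\infty)$ and an arbitrary positive measure space $(X,\mathfrak{M},\mu)$. $L^p(\mu)$ is the Banach space over $\mathbb{K}$ of all $\mathbb{K}$-valued $p$-integrable functions with norm $\|\varphi\|_p = (\int_X |\varphi|^p d\mu)^{1/p}$. A weighted composition operator on $L^p(\mu)$ is the map $C_{w,f}(\varphi) = (\varphi \circ f)\cdot w$, where $w : X \to \mathbb{K}$ is measurable with $\varphi\cdot w \in L^p(\mu)$ for all $\varphi \in L^p(\mu)$, $f : X \to X$ is bimeasurable (i.e. $f(B) \in \mathfrak{M}$ and $f^{-1}(B) \in \mathfrak{M}$ whenever $B \in \mathfrak{M}$), and there is a constant $c \in (0,\infty)$ such that $\int_B |w|^p d\mu \le c\,\mu(f(B))$ for every $B \in \mathfrak{M}$; these conditions make $C_{w,f}$ a well-defined bounded linear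 operator on $L^p(\mu)$. Put $w^{(1)} = w$, $w^{(n)} = (w\circ f^{n-1})\cdots(w\circ f)\cdot w$ for $n \ge 2$, and $\mu_n(B) = \int_B |w^{(n)}|^p d\mu$ for $B \in \mathfrak{M}$, $n \in \mathbb{N} = \{1,2,\ldots\}$. An operator $T$ on a Banach space $Y$ is $p$-absolutely Cesàro bounded if there exists $C \in (0,\infty)$ such that $\sup_{N\in\mathbb{N}} \frac{1}{N}\sum_{n=1}^N \|T^n y\|^p \le C\|y\|^p$ for all $y \in Y$. One defines the extended real number $N_p(T) = \sup_{\|y\|=1}\sup_{N\in\mathbb{N}} \frac{1}{N}\sum_{n=1}^N \|T^n y\|^p \in [0,\infty]$. All suprema are taken in $[0,\infty]$. *)

theory Defs
  imports "HOL-Analysis.Analysis"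
begin

section \<open>The space \<open>L\<^sup>p(\<mu>)\<close>\<close>

text \<open>
  The scalar field is a type of sort \<open>{real_normed_field, euclidean_space}\<close>: a finite-dimensional
  field extension of the reals with a multiplicative norm. By Frobenius' theorem the only ones are
  the reals and the complex numbers, and both \<^typ>\<open>real\<close> and \<^typ>\<open>complex\<close> are instances.
\<close>

definition Lp_funs ::
    "'a measure \<Rightarrow> real \<Rightarrow> ('a \<Rightarrow> 'k::{real_normed_field, euclidean_space}) set" where
  "Lp_funs M p = {\<phi> \<in> borel_measurable M. integrable M (\<lambda>x. norm (\<phi> x) powr p)}"

definition Lp_seminorm ::
    "'a measure \<Rightarrow> real \<Rightarrow> ('a \<Rightarrow> 'k::{real_normed_field, euclidean_space}) \<Rightarrow> real" where
  "Lp_seminorm M p \<phi> = (LINT x|M. norm (\<phi> x) powr p) powr (1 / p)"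

definition Lp_eq ::
    "'a measure \<Rightarrow> real \<Rightarrow> (('a \<Rightarrow> 'k::{real_normed_field, euclidean_space}) \<times> ('a \<Rightarrow> 'k)) set" where
  "Lp_eq M p = {(\<phi>, \<psi>). \<phi> \<in> Lp_funs M p \<and> \<psi> \<in> Lp_funs M p \<and> (AE x in M. \<phi> x = \<psi> x)}"

text \<open>
  Elements of \<open>L\<^sup>p(\<mu>)\<close> are classes of \<open>p\<close>-integrable functions modulo equality almost everywhere.
\<close>

definition Lp ::
    "'a measure \<Rightarrow> real \<Rightarrow> ('a \<Rightarrow> 'k::{real_normed_field, euclidean_space}) set set" where
  "Lp M p = Lp_funs M p // Lp_eq M p"

text \<open>
  The seminorm is constant on each class; see \<open>Lp_norm_class\<close> below.
\<close>

definition Lp_norm ::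
    "'a measure \<Rightarrow> real \<Rightarrow> ('a \<Rightarrow> 'k::{real_normed_field, euclidean_space}) set \<Rightarrow> real" where
  "Lp_norm M p c = the_elem (Lp_seminorm M p ` c)"


section \<open>Weighted composition operators\<close>

definition bimeasurable :: "'a measure \<Rightarrow> ('a \<Rightarrow> 'a) \<Rightarrow> bool" where
  "bimeasurable M f \<longleftrightarrow> f \<in> measurable M M \<and> (\<forall>B\<in>sets M. f ` B \<in> sets M)"

definition wcomp_data ::
    "'a measure \<Rightarrow> real \<Rightarrow> ('a \<Rightarrow> 'k::{real_normed_field, euclidean_space}) \<Rightarrow> ('a \<Rightarrow> 'a) \<Rightarrow> bool"
  where
  "wcomp_data M p w f \<longleftrightarrow>
     w \<in> borel_measurable M \<and>
     (\<forall>\<phi>\<in>Lp_funs M p. (\<lambda>x. \<phi> x * w x) \<in> Lp_funs M p) \<and>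
     bimeasurable M f \<and>
     (\<exists>c::real. 0 < c \<and>
        (\<forall>B\<in>sets M. (\<integral>\<^sup>+x\<in>B. ennreal (norm (w x) powr p) \<partial>M) \<le> ennreal c * emeasure M (f ` B)))"

definition wcomp_fun :: "('a \<Rightarrow> 'k::{real_normed_field, euclidean_space}) \<Rightarrow> ('a \<Rightarrow> 'a) \<Rightarrow>
    ('a \<Rightarrow> 'k) \<Rightarrow> ('a \<Rightarrow> 'k)" where
  "wcomp_fun w f \<phi> = (\<lambda>x. \<phi> (f x) * w x)"

text \<open>
  The operator on classes is induced by \<^const>\<open>wcomp_fun\<close>; see \<open>wcomp_class\<close> below.
\<close>

definition wcomp :: "'a measure \<Rightarrow> real \<Rightarrow> ('a \<Rightarrow> 'k::{real_normed_field, euclidean_space}) \<Rightarrow>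
    ('a \<Rightarrow> 'a) \<Rightarrow> ('a \<Rightarrow> 'k) set \<Rightarrow> ('a \<Rightarrow> 'k) set" where
  "wcomp M p w f c = (\<Union>\<phi>\<in>c. Lp_eq M p `` {wcomp_fun w f \<phi>})"

definition iter_weight ::
    "('a \<Rightarrow> 'k::{real_normed_field, euclidean_space}) \<Rightarrow> ('a \<Rightarrow> 'a) \<Rightarrow> nat \<Rightarrow> 'a \<Rightarrow> 'k" where
  "iter_weight w f n x = (\<Prod>i<n. w ((f ^^ i) x))"

definition iter_measure :: "'a measure \<Rightarrow> real \<Rightarrow> ('a \<Rightarrow> 'k::{real_normed_field, euclidean_space}) \<Rightarrow>
    ('a \<Rightarrow> 'a) \<Rightarrow> nat \<Rightarrow> 'a set \<Rightarrow> ennreal" where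
  "iter_measure M p w f n B = (\<integral>\<^sup>+x\<in>B. ennreal (norm (iter_weight w f n x) powr p) \<partial>M)"


section \<open>Absolute Cesaro boundedness\<close>

text \<open>
  The type of \<open>L\<^sup>p(\<mu>)\<close> cannot depend on \<open>\<mu>\<close> and \<open>p\<close>, so a normed space is given here by its carrier
  \<open>Y\<close> and its norm \<open>nrm\<close>.
\<close>

definition abs_Cesaro_sup :: "real \<Rightarrow> ('y \<Rightarrow> real) \<Rightarrow> ('y \<Rightarrow> 'y) \<Rightarrow> 'y \<Rightarrow> ennreal" where
  "abs_Cesaro_sup p nrm T y =
     (SUP N\<in>{1::nat..}. 1 / of_nat N * (\<Sum>n=1..N. ennreal (nrm ((T ^^ n) y) powr p)))"

definition abs_Cesaro_bounded ::
    "real \<Rightarrow> 'y set \<Rightarrow> ('y \<Rightarrow> real) \<Rightarrow> ('y \<Rightarrow> 'y) \<Rightarrow> bool" where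
  "abs_Cesaro_bounded p Y nrm T \<longleftrightarrow>
     (\<exists>C::real. 0 < C \<and> (\<forall>y\<in>Y. abs_Cesaro_sup p nrm T y \<le> ennreal (C * nrm y powr p)))"

definition Np :: "real \<Rightarrow> 'y set \<Rightarrow> ('y \<Rightarrow> real) \<Rightarrow> ('y \<Rightarrow> 'y) \<Rightarrow> ennreal" where
  "Np p Y nrm T = (SUP y\<in>{y \<in> Y. nrm y = 1}. abs_Cesaro_sup p nrm T y)"


section \<open>Well-definedness on classes\<close>

lemma Lp_eq_equiv: "equiv (Lp_funs M p) (Lp_eq M p)"
proof (rule equivI)
  show "Lp_eq M p \<subseteq> Lp_funs M p \<times> Lp_funs M p" by (auto simp: Lp_eq_def)
  show "refl_on (Lp_funs M p) (Lp_eq M p)" by (auto simp: refl_on_def Lp_eq_def)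
  show "sym (Lp_eq M p)" by (auto simp: sym_def Lp_eq_def eq_commute)
  show "trans (Lp_eq M p)"
  proof (rule transI)
    fix a b c assume ab: "(a, b) \<in> Lp_eq M p" and bc: "(b, c) \<in> Lp_eq M p"
    from ab bc have "AE x in M. a x = b x" "AE x in M. b x = c x" by (auto simp: Lp_eq_def)
    then have "AE x in M. a x = c x" by eventually_elim simp
    with ab bc show "(a, c) \<in> Lp_eq M p" by (auto simp: Lp_eq_def)
  qed
qed

lemma Lp_seminorm_cong:
  assumes "(\<phi>, \<psi>) \<in> Lp_eq M p"
  shows "Lp_seminorm M p \<phi> = Lp_seminorm M p \<psi>"
proof -
  have [measurable]: "\<phi> \<in> borel_measurable M" "\<psi> \<in> borel_measurable M"
    and "AE x in M. \<phi> x = \<psi> x"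
    using assms by (auto simp: Lp_eq_def Lp_funs_def)
  then have "AE x in M. norm (\<phi> x) powr p = norm (\<psi> x) powr p" by auto
  then have "(LINT x|M. norm (\<phi> x) powr p) = (LINT x|M. norm (\<psi> x) powr p)"
    by (intro integral_cong_AE) auto
  then show ?thesis by (simp add: Lp_seminorm_def)
qed

lemma Lp_norm_class:
  assumes "\<phi> \<in> Lp_funs M p"
  shows "Lp_norm M p (Lp_eq M p `` {\<phi>}) = Lp_seminorm M p \<phi>"
proof -
  have "(\<phi>, \<phi>) \<in> Lp_eq M p" using assms by (simp add: Lp_eq_def)
  then have "Lp_seminorm M p ` (Lp_eq M p `` {\<phi>}) = {Lp_seminorm M p \<phi>}"
    by (metis (no_types, lifting) Image_singleton_iff Lp_seminorm_cong image_cong image_constant)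
  then show ?thesis by (simp add: Lp_norm_def)
qed

lemma nn_integral_wcomp_le:
  assumes w[measurable]: "w \<in> borel_measurable M" and f[measurable]: "f \<in> measurable M M"
    and c: "\<And>B. B \<in> sets M \<Longrightarrow>
      (\<integral>\<^sup>+x\<in>B. ennreal (norm (w x) powr p) \<partial>M) \<le> c * emeasure M (f ` B)"
    and h[measurable]: "h \<in> borel_measurable M"
  shows "(\<integral>\<^sup>+x. h (f x) * ennreal (norm (w x) powr p) \<partial>M) \<le> c * (\<integral>\<^sup>+x. h x \<partial>M)"
proof -
  let ?g = "\<lambda>x. ennreal (norm (w x) powr p)"
  let ?D = "distr (density M ?g) M f"
  have [measurable]: "f \<in> measurable (density M ?g) M" by simp
  have "?D \<le> scale_measure c M"
  proof (subst le_measure)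
    show "\<forall>A\<in>sets ?D. emeasure ?D A \<le> emeasure (scale_measure c M) A"
    proof
      fix A assume "A \<in> sets ?D"
      then have [measurable]: "A \<in> sets M" by simp
      let ?B = "f -` A \<inter> space M"
      have B: "?B \<in> sets M" by measurable
      have "emeasure ?D A = (\<integral>\<^sup>+x\<in>?B. ?g x \<partial>M)"
        by (simp add: emeasure_distr emeasure_density)
      also have "\<dots> \<le> c * emeasure M (f ` ?B)" by (rule c[OF B])
      also have "\<dots> \<le> c * emeasure M A" by (intro mult_left_mono emeasure_mono) auto
      finally show "emeasure ?D A \<le> emeasure (scale_measure c M) A" by simp
    qed
  qed simp
  then have "(\<integral>\<^sup>+x. h x \<partial>?D) \<le> (\<integral>\<^sup>+x. h x \<partial>scale_measure c M)"
    by (intro nn_integral_mono_measure) auto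
  then show ?thesis
    by (simp add: nn_integral_distr nn_integral_density nn_integral_scale_measure mult.commute)
qed

lemma wcomp_fun_in_Lp_funs:
  assumes W: "wcomp_data M p w f" and \<phi>: "\<phi> \<in> Lp_funs M p"
  shows "wcomp_fun w f \<phi> \<in> Lp_funs M p"
proof -
  from W obtain c :: real where w[measurable]: "w \<in> borel_measurable M"
    and f[measurable]: "f \<in> measurable M M"
    and c: "\<And>B. B \<in> sets M \<Longrightarrow>
      (\<integral>\<^sup>+x\<in>B. ennreal (norm (w x) powr p) \<partial>M) \<le> ennreal c * emeasure M (f ` B)"
    unfolding wcomp_data_def bimeasurable_def by blast
  have [measurable]: "\<phi> \<in> borel_measurable M" and int: "integrable M (\<lambda>x. norm (\<phi> x) powr p)"
    using \<phi> by (auto simp: Lp_funs_def)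
  have "(\<integral>\<^sup>+x. ennreal (norm (\<phi> (f x) * w x) powr p) \<partial>M)
      = (\<integral>\<^sup>+x. ennreal (norm (\<phi> (f x)) powr p) * ennreal (norm (w x) powr p) \<partial>M)"
    by (simp add: norm_mult powr_mult ennreal_mult)
  also have "\<dots> \<le> ennreal c * (\<integral>\<^sup>+x. ennreal (norm (\<phi> x) powr p) \<partial>M)"
    by (rule nn_integral_wcomp_le[OF w f c, where h = "\<lambda>x. ennreal (norm (\<phi> x) powr p)"]) auto
  also have "\<dots> < \<infinity>"
    using int by (auto simp: integrable_iff_bounded ennreal_mult_less_top)
  finally show ?thesis
    by (auto simp: Lp_funs_def wcomp_fun_def integrable_iff_bounded)
qed

lemma wcomp_fun_cong:
  assumes W: "wcomp_data M p w f" and eq: "(\<phi>, \<psi>) \<in> Lp_eq M p"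
  shows "(wcomp_fun w f \<phi>, wcomp_fun w f \<psi>) \<in> Lp_eq M p"
proof -
  from W obtain c :: real where w[measurable]: "w \<in> borel_measurable M"
    and f[measurable]: "f \<in> measurable M M"
    and c: "\<And>B. B \<in> sets M \<Longrightarrow>
      (\<integral>\<^sup>+x\<in>B. ennreal (norm (w x) powr p) \<partial>M) \<le> ennreal c * emeasure M (f ` B)"
    unfolding wcomp_data_def bimeasurable_def by blast
  have \<phi>\<psi>: "\<phi> \<in> Lp_funs M p" "\<psi> \<in> Lp_funs M p" and ae: "AE x in M. \<phi> x = \<psi> x"
    using eq by (auto simp: Lp_eq_def)
  then have [measurable]: "\<phi> \<in> borel_measurable M" "\<psi> \<in> borel_measurable M"
    by (auto simp: Lp_funs_def)
  let ?h = "\<lambda>x. ennreal (norm (\<phi> x - \<psi> x))"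
  have "(\<integral>\<^sup>+x. ?h x \<partial>M) = 0"
    using ae by (subst nn_integral_0_iff_AE) auto
  moreover have "(\<integral>\<^sup>+x. ?h (f x) * ennreal (norm (w x) powr p) \<partial>M) \<le> ennreal c * (\<integral>\<^sup>+x. ?h x \<partial>M)"
    by (rule nn_integral_wcomp_le[OF w f c, where h = ?h]) auto
  ultimately have "(\<integral>\<^sup>+x. ?h (f x) * ennreal (norm (w x) powr p) \<partial>M) = 0" by simp
  then have "AE x in M. ?h (f x) * ennreal (norm (w x) powr p) = 0"
    by (subst (asm) nn_integral_0_iff_AE) auto
  then have "AE x in M. \<phi> (f x) * w x = \<psi> (f x) * w x"
    by eventually_elim (auto simp: ennreal_eq_0_iff)
  then show ?thesis
    using wcomp_fun_in_Lp_funs[OF W] \<phi>\<psi> by (auto simp: Lp_eq_def wcomp_fun_def)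
qed

lemma wcomp_class:
  assumes "wcomp_data M p w f" "\<phi> \<in> Lp_funs M p"
  shows "wcomp M p w f (Lp_eq M p `` {\<phi>}) = Lp_eq M p `` {wcomp_fun w f \<phi>}"
proof -
  have "congruent (Lp_eq M p) (\<lambda>\<phi>. Lp_eq M p `` {wcomp_fun w f \<phi>})"
    using wcomp_fun_cong[OF assms(1)] by (auto intro!: congruentI equiv_class_eq[OF Lp_eq_equiv])
  then show ?thesis
    unfolding wcomp_def using UN_equiv_class[OF Lp_eq_equiv _ assms(2)] by blast
qed

lemma wcomp_in_Lp:
  assumes "wcomp_data M p w f" "c \<in> Lp M p"
  shows "wcomp M p w f c \<in> Lp M p"
  using assms unfolding Lp_def
  by (auto elim!: quotientE simp: wcomp_class intro!: quotientI wcomp_fun_in_Lp_funs)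

end

theory Submission
  imports Defs
begin

text \<open>
  Transporting \<open>|w\<^sup>(\<^sup>n\<^sup>)|\<^sup>p d\<mu>\<close> along \<open>f\<^sup>n\<close> gives a measure \<open>\<nu>\<^sub>n\<close> with
  \<open>\<parallel>T\<^sup>n \<phi>\<parallel>\<^sup>p = \<integral> |\<phi>|\<^sup>p d\<nu>\<^sub>n\<close> and \<open>\<nu>\<^sub>n(B) = \<mu>\<^sub>n(f\<^sup>-\<^sup>n(B))\<close>. A Cesaro bound for the \<open>\<nu>\<^sub>n\<close> on sets
  therefore extends to all nonnegative functions by monotone approximation, and conversely the
  bound on sets is the one on functions evaluated at indicators. A bound with a constant \<open>C > 0\<close>
  on the sets of finite positive measure holds on all sets: for infinite measure it is trivial, and
  \<open>\<nu>\<^sub>n \<lless> \<mu>\<close> settles the null sets.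
\<close>

section \<open>Passing from sets to nonnegative functions\<close>

lemma sum_nn_integral_le:
  fixes a C :: ennreal and \<nu> :: "'i \<Rightarrow> 'a measure"
  assumes sets[measurable_cong]: "\<And>i. sets (\<nu> i) = sets M"
    and le: "\<And>A. A \<in> sets M \<Longrightarrow> a * (\<Sum>i\<in>I. emeasure (\<nu> i) A) \<le> C * emeasure M A"
    and h: "h \<in> borel_measurable M"
  shows "a * (\<Sum>i\<in>I. \<integral>\<^sup>+x. h x \<partial>\<nu> i) \<le> C * (\<integral>\<^sup>+x. h x \<partial>M)"
  using h
proof (induction rule: borel_measurable_induct)
  case (cong g h)
  have "space (\<nu> i) = space M" for i by (rule sets_eq_imp_space_eq[OF sets])
  then have "(\<integral>\<^sup>+x. g x \<partial>\<nu> i) = (\<integral>\<^sup>+x. h x \<partial>\<nu> i)" for i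
    using cong by (intro nn_integral_cong) auto
  moreover have "(\<integral>\<^sup>+x. g x \<partial>M) = (\<integral>\<^sup>+x. h x \<partial>M)"
    using cong by (intro nn_integral_cong) auto
  ultimately show ?case using cong by simp
next
  case (set A)
  then show ?case using le by (simp add: sets)
next
  case (mult u c)
  note [measurable] = mult.hyps(2)
  have "a * (\<Sum>i\<in>I. \<integral>\<^sup>+x. c * u x \<partial>\<nu> i) = c * (a * (\<Sum>i\<in>I. \<integral>\<^sup>+x. u x \<partial>\<nu> i))"
    by (simp add: nn_integral_cmult sum_distrib_left[symmetric] mult.left_commute)
  also have "\<dots> \<le> c * (C * (\<integral>\<^sup>+x. u x \<partial>M))"
    using mult.IH by (rule mult_left_mono) simp
  also have "\<dots> = C * (\<integral>\<^sup>+x. c * u x \<partial>M)"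
    by (simp add: nn_integral_cmult mult.left_commute)
  finally show ?case .
next
  case (add u v)
  note [measurable] = add.hyps(1,3)
  show ?case
    using add_mono[OF add.IH] by (simp add: nn_integral_add sum.distrib distrib_left add.commute)
next
  case (seq U)
  note [measurable] = seq.hyps(1)
  have mono: "incseq (\<lambda>k. \<integral>\<^sup>+x. U k x \<partial>\<nu> i)" for i
    using seq.hyps(3) by (auto simp: incseq_def le_fun_def intro!: nn_integral_mono)
  have "a * (\<Sum>i\<in>I. \<integral>\<^sup>+x. (SUP k. U k) x \<partial>\<nu> i)
      = a * (\<Sum>i\<in>I. SUP k. \<integral>\<^sup>+x. U k x \<partial>\<nu> i)"
    using seq.hyps(3) by (simp add: image_image nn_integral_monotone_convergence_SUP)
  \<comment> \<open>Suprema over \<open>k\<close> commute with the sum over \<open>I\<close> because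
    every summand increases in \<open>k\<close>.\<close>
  also have "\<dots> = (SUP k. a * (\<Sum>i\<in>I. \<integral>\<^sup>+x. U k x \<partial>\<nu> i))"
    unfolding ennreal_SUP_sum[OF mono, symmetric] by (rule SUP_mult_left_ennreal)
  also have "\<dots> \<le> C * (\<integral>\<^sup>+x. (SUP k. U k) x \<partial>M)"
  proof (rule SUP_least)
    fix k
    have "C * (\<integral>\<^sup>+x. U k x \<partial>M) \<le> C * (\<integral>\<^sup>+x. (SUP k. U k) x \<partial>M)"
      by (intro mult_left_mono nn_integral_mono) (auto simp: image_image intro: SUP_upper)
    with seq.IH[of k]
    show "a * (\<Sum>i\<in>I. \<integral>\<^sup>+x. U k x \<partial>\<nu> i) \<le> C * (\<integral>\<^sup>+x. (SUP k. U k) x \<partial>M)"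
      by (rule order_trans)
  qed
  finally show ?case by simp
qed

section \<open>Test functions and iterates of the operator on functions\<close>

lemma Lp_seminorm_powr:
  assumes "1 \<le> p" "\<phi> \<in> Lp_funs M p"
  shows "ennreal (Lp_seminorm M p \<phi> powr p) = (\<integral>\<^sup>+x. ennreal (norm (\<phi> x) powr p) \<partial>M)"
  using assms
  by (simp add: Lp_seminorm_def powr_powr Lp_funs_def nn_integral_eq_integral)

text \<open>These are the functions on which the operator is tested: \<open>r = 1\<close> for the
  boundedness criterion, and the normalising factor \<open>r\<close> for \<open>Np\<close>.\<close>

lemma scaled_indicator_in_Lp_funs:
  assumes "B \<in> sets M" "emeasure M B < \<infinity>"
  shows "(\<lambda>x. of_real r * indicator B x) \<in> Lp_funs M p"
proof -
  \<comment> \<open>Off \<open>B\<close> this rests on \<open>0 powr p = 0\<close>.\<close>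
  have "norm (of_real r * indicator B x :: 'b) powr p = \<bar>r\<bar> powr p * indicator B x" for x
    by (simp add: indicator_def)
  then show ?thesis using assms by (simp add: Lp_funs_def)
qed

lemma wcomp_fun_funpow:
  "(wcomp_fun w f ^^ n) \<phi> = (\<lambda>x. \<phi> ((f ^^ n) x) * iter_weight w f n x)"
proof (induction n)
  case (Suc n)
  show ?case
    unfolding funpow.simps o_apply Suc.IH
    \<comment> \<open>The cocycle rule here is that the weight of order \<open>Suc n\<close> at
      \<open>x\<close> is \<open>w x\<close> times the weight of order \<open>n\<close> at
      \<open>f x\<close>, so the product must be split at its first factor and not at its
      last.\<close>
    by (simp add: wcomp_fun_def iter_weight_def prod.lessThan_Suc_shift funpow_swap1 mult_ac
        del: prod.lessThan_Suc)
qed (simp add: iter_weight_def)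

section \<open>Transported measures and norms of iterates\<close>

definition orbit_measure :: "'a measure \<Rightarrow> real \<Rightarrow>
    ('a \<Rightarrow> 'k::{real_normed_field, euclidean_space}) \<Rightarrow> ('a \<Rightarrow> 'a) \<Rightarrow> nat \<Rightarrow> 'a measure" where
  "orbit_measure M p w f n =
     distr (density M (\<lambda>x. ennreal (norm (iter_weight w f n x) powr p))) M (f ^^ n)"

lemma sets_orbit_measure [simp, measurable_cong]: "sets (orbit_measure M p w f n) = sets M"
  by (simp add: orbit_measure_def)

locale weighted_composition =
  fixes M :: "'a measure" and p :: real
    and w :: "'a \<Rightarrow> 'k::{real_normed_field, euclidean_space}" and f :: "'a \<Rightarrow> 'a"
  assumes W: "wcomp_data M p w f"
begin

lemma weight_measurable [measurable]: "w \<in> borel_measurable M"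
  and map_measurable [measurable]: "f \<in> measurable M M"
  using W by (auto simp: wcomp_data_def bimeasurable_def)

lemma funpow_measurable [measurable]: "f ^^ n \<in> measurable M M"
  by (rule measurable_compose_n) (rule map_measurable)

lemma iter_weight_measurable [measurable]: "iter_weight w f n \<in> borel_measurable M"
  unfolding iter_weight_def[abs_def] by measurable

lemma nn_integral_orbit_measure:
  assumes [measurable]: "h \<in> borel_measurable M"
  shows "(\<integral>\<^sup>+x. h x \<partial>orbit_measure M p w f n)
    = (\<integral>\<^sup>+x. h ((f ^^ n) x) * ennreal (norm (iter_weight w f n x) powr p) \<partial>M)"
  by (simp add: orbit_measure_def nn_integral_distr nn_integral_density mult.commute)

lemma emeasure_orbit_measure:
  assumes "B \<in> sets M"
  shows "emeasure (orbit_measure M p w f n) B = iter_measure M p w f n ((f ^^ n) -` B \<inter> space M)"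
  using assms
  by (simp add: orbit_measure_def iter_measure_def emeasure_distr emeasure_density)

lemma wcomp_fun_funpow_in_Lp_funs:
  "\<phi> \<in> Lp_funs M p \<Longrightarrow> (wcomp_fun w f ^^ n) \<phi> \<in> Lp_funs M p"
  by (induction n) (auto intro: wcomp_fun_in_Lp_funs[OF W])

lemma wcomp_funpow_class:
  "\<phi> \<in> Lp_funs M p \<Longrightarrow>
    (wcomp M p w f ^^ n) (Lp_eq M p `` {\<phi>}) = Lp_eq M p `` {(wcomp_fun w f ^^ n) \<phi>}"
  by (induction n) (simp_all add: wcomp_class[OF W] wcomp_fun_funpow_in_Lp_funs)

text \<open>A representative of the iterated class is \<open>\<phi>\<close> composed with
  \<open>f ^^ n\<close>, times the iterated weight. The power of its norm splits into a function of
  \<open>f ^^ n\<close> and the density of the transported measure, so a change of variables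
  applies.\<close>

lemma Lp_norm_wcomp_funpow:
  assumes p: "1 \<le> p" and \<phi>: "\<phi> \<in> Lp_funs M p"
  shows "ennreal (Lp_norm M p ((wcomp M p w f ^^ n) (Lp_eq M p `` {\<phi>})) powr p)
    = (\<integral>\<^sup>+x. ennreal (norm (\<phi> x) powr p) \<partial>orbit_measure M p w f n)"
proof -
  have [measurable]: "\<phi> \<in> borel_measurable M" using \<phi> by (simp add: Lp_funs_def)
  have "ennreal (Lp_norm M p ((wcomp M p w f ^^ n) (Lp_eq M p `` {\<phi>})) powr p)
      = (\<integral>\<^sup>+x. ennreal (norm ((wcomp_fun w f ^^ n) \<phi> x) powr p) \<partial>M)"
    using p \<phi>
    by (simp add: wcomp_funpow_class Lp_norm_class Lp_seminorm_powr wcomp_fun_funpow_in_Lp_funs)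
  also have "\<dots> = (\<integral>\<^sup>+x. ennreal (norm (\<phi> x) powr p) \<partial>orbit_measure M p w f n)"
    by (simp add: nn_integral_orbit_measure wcomp_fun_funpow norm_mult powr_mult ennreal_mult)
  finally show ?thesis .
qed

lemma abs_Cesaro_sup_wcomp:
  assumes "1 \<le> p" "\<phi> \<in> Lp_funs M p"
  shows "abs_Cesaro_sup p (Lp_norm M p) (wcomp M p w f) (Lp_eq M p `` {\<phi>})
    = (SUP N\<in>{1::nat..}. 1 / of_nat N *
        (\<Sum>n=1..N. \<integral>\<^sup>+x. ennreal (norm (\<phi> x) powr p) \<partial>orbit_measure M p w f n))"
  using assms by (simp add: abs_Cesaro_sup_def Lp_norm_wcomp_funpow)

lemma abs_Cesaro_sup_scaled_indicator:
  assumes "1 \<le> p" "B \<in> sets M" "emeasure M B < \<infinity>"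
  shows "abs_Cesaro_sup p (Lp_norm M p) (wcomp M p w f)
      (Lp_eq M p `` {\<lambda>x. of_real r * indicator B x})
    = (SUP N\<in>{1::nat..}. 1 / of_nat N *
        (\<Sum>n=1..N. ennreal (\<bar>r\<bar> powr p) * emeasure (orbit_measure M p w f n) B))"
proof -
  have "ennreal (norm (of_real r * indicator B x :: 'k) powr p)
      = ennreal (\<bar>r\<bar> powr p) * indicator B x" for x
    by (simp add: indicator_def)
  then show ?thesis
    using assms
    by (simp add: abs_Cesaro_sup_wcomp scaled_indicator_in_Lp_funs nn_integral_cmult)
qed

lemma Lp_norm_scaled_indicator:
  assumes "1 \<le> p" "B \<in> sets M" "emeasure M B < \<infinity>"
  shows "Lp_norm M p (Lp_eq M p `` {\<lambda>x. of_real r * indicator B x :: 'k}) powr p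
    = \<bar>r\<bar> powr p * measure M B"
proof -
  have "norm (of_real r * indicator B x :: 'k) powr p = \<bar>r\<bar> powr p * indicator B x" for x
    by (simp add: indicator_def)
  then show ?thesis
    using assms
    by (simp add: Lp_norm_class scaled_indicator_in_Lp_funs Lp_seminorm_def powr_powr
        zero_le_mult_iff)
qed

text \<open>Absolute continuity comes from well-definedness on classes: the indicator of a null set
  represents zero, hence so do its iterates under \<open>wcomp_fun\<close>, and the integrand giving
  the transported measure of \<open>B\<close> vanishes almost everywhere.\<close>

lemma emeasure_orbit_measure_null:
  assumes B: "B \<in> sets M" "emeasure M B = 0"
  shows "emeasure (orbit_measure M p w f n) B = 0"
proof -
  have "AE x in M. x \<notin> B" using B by (intro AE_not_in) auto
  then have ae: "AE x in M. indicator B x = (0::'k)" by eventually_elim simp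
  have mem: "(indicator B :: 'a \<Rightarrow> 'k) \<in> Lp_funs M p"
    using scaled_indicator_in_Lp_funs[of B M 1 p] B by simp
  have "(\<lambda>x. 0 :: 'k) \<in> Lp_funs M p" by (simp add: Lp_funs_def)
  with ae mem have "(indicator B, \<lambda>x. 0 :: 'k) \<in> Lp_eq M p" by (simp add: Lp_eq_def)
  then have "((wcomp_fun w f ^^ n) (indicator B), (wcomp_fun w f ^^ n) (\<lambda>x. 0)) \<in> Lp_eq M p"
    by (induction n) (auto intro: wcomp_fun_cong[OF W])
  then have "AE x in M. indicator B ((f ^^ n) x) * iter_weight w f n x = 0"
    by (simp add: Lp_eq_def wcomp_fun_funpow)
  then have ae0: "AE x in M.
      indicator B ((f ^^ n) x) * ennreal (norm (iter_weight w f n x) powr p) = 0"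
    by eventually_elim (auto simp: indicator_def)
  have "emeasure (orbit_measure M p w f n) B
      = (\<integral>\<^sup>+x. indicator B ((f ^^ n) x) * ennreal (norm (iter_weight w f n x) powr p) \<partial>M)"
    using B nn_integral_orbit_measure[of "indicator B" n] by simp
  also have "\<dots> = (\<integral>\<^sup>+x. 0 \<partial>M)" using ae0 by (rule nn_integral_cong_AE)
  finally show ?thesis by simp
qed

section \<open>Cesaro bounds for the operator\<close>

lemma abs_Cesaro_sup_le:
  fixes C :: ennreal
  assumes p: "1 \<le> p" and C: "0 < C" and y: "y \<in> Lp M p"
    and le: "\<And>B N. B \<in> sets M \<Longrightarrow> 0 < emeasure M B \<Longrightarrow> emeasure M B < \<infinity> \<Longrightarrow> 1 \<le> N \<Longrightarrow>
      1 / of_nat N * (\<Sum>n=1..N. emeasure (orbit_measure M p w f n) B) \<le> C * emeasure M B"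
  shows "abs_Cesaro_sup p (Lp_norm M p) (wcomp M p w f) y \<le> C * ennreal (Lp_norm M p y powr p)"
proof -
  obtain \<phi> where \<phi>: "\<phi> \<in> Lp_funs M p" and y_eq: "y = Lp_eq M p `` {\<phi>}"
    using y by (auto simp: Lp_def elim: quotientE)
  then have [measurable]: "\<phi> \<in> borel_measurable M" by (simp add: Lp_funs_def)
  have le': "1 / of_nat N * (\<Sum>n=1..N. emeasure (orbit_measure M p w f n) B) \<le> C * emeasure M B"
    if "B \<in> sets M" "1 \<le> N" for B N
  proof -
    consider "emeasure M B = 0" | "0 < emeasure M B" "emeasure M B < \<infinity>" | "emeasure M B = \<infinity>"
      by (metis infinity_ennreal_def not_gr_zero top.not_eq_extremum)
    then show ?thesis
    proof cases
      case 1
      then show ?thesis using that by (simp add: emeasure_orbit_measure_null)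
    next
      case 2
      then show ?thesis using that le by blast
    next
      case 3
      \<comment> \<open>Positivity of \<open>C\<close> matters here: the right-hand side is then
        infinite, whereas zero times infinity is zero in \<open>ennreal\<close>.\<close>
      then show ?thesis using C by (simp add: ennreal_mult_top)
    qed
  qed
  have "1 / of_nat N *
      (\<Sum>n=1..N. \<integral>\<^sup>+x. ennreal (norm (\<phi> x) powr p) \<partial>orbit_measure M p w f n)
    \<le> C * (\<integral>\<^sup>+x. ennreal (norm (\<phi> x) powr p) \<partial>M)" if "1 \<le> N" for N :: nat
    using le' that by (intro sum_nn_integral_le) auto
  then show ?thesis
    using p \<phi> by (auto simp: y_eq abs_Cesaro_sup_wcomp Lp_norm_class Lp_seminorm_powr
        intro!: SUP_least)
qed

lemma scaled_indicator_in_Lp: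
  assumes "B \<in> sets M" "emeasure M B < \<infinity>"
  shows "Lp_eq M p `` {\<lambda>x. of_real r * indicator B x} \<in> Lp M p"
  using assms by (auto simp: Lp_def intro!: quotientI scaled_indicator_in_Lp_funs)

text \<open>The upper bound extends the estimate on sets to every \<open>y\<close> of norm one; the
  lower bound tests the operator on indicators scaled to norm one.\<close>

lemma Np_wcomp:
  assumes p: "1 \<le> p"
  shows "Np p (Lp M p) (Lp_norm M p) (wcomp M p w f) =
    (SUP B\<in>{B \<in> sets M. 0 < emeasure M B \<and> emeasure M B < \<infinity>}. SUP N\<in>{1::nat..}.
       1 / of_nat N * (\<Sum>n=1..N. emeasure (orbit_measure M p w f n) B / emeasure M B))"
    (is "_ = ?S")
proof (rule antisym)
  show "Np p (Lp M p) (Lp_norm M p) (wcomp M p w f) \<le> ?S"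
  \<comment> \<open>The supremum itself may be zero, while \<open>abs_Cesaro_sup_le\<close> asks for
    a positive constant. Any \<open>C\<close> strictly above it is positive, possibly
    infinite.\<close>
  proof (rule dense_ge)
    fix C assume C: "?S < C"
    have "1 / of_nat N * (\<Sum>n=1..N. emeasure (orbit_measure M p w f n) B) \<le> C * emeasure M B"
      if B: "B \<in> sets M" "0 < emeasure M B" "emeasure M B < \<infinity>" and N: "1 \<le> N" for B N
    proof -
      have "1 / of_nat N * (\<Sum>n=1..N. emeasure (orbit_measure M p w f n) B / emeasure M B) \<le> ?S"
        using B N by (intro SUP_upper2[of B] SUP_upper2[of N]) auto
      also have "\<dots> \<le> C" using C by simp
      finally have "(1 / of_nat N * (\<Sum>n=1..N. emeasure (orbit_measure M p w f n) B))
          / emeasure M B \<le> C"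
        by (simp add: divide_ennreal_def sum_distrib_right[symmetric] mult.assoc)
      then have "(1 / of_nat N * (\<Sum>n=1..N. emeasure (orbit_measure M p w f n) B))
          / emeasure M B * emeasure M B \<le> C * emeasure M B"
        by (rule mult_right_mono) simp
      then show ?thesis
        \<comment> \<open>The measure of \<open>B\<close> cancels because it is neither zero nor
          infinite.\<close>
        using B by (simp add: ennreal_divide_times[of _ "emeasure M B" "emeasure M B"])
    qed
    then have "abs_Cesaro_sup p (Lp_norm M p) (wcomp M p w f) y \<le> C"
      if "y \<in> Lp M p" "Lp_norm M p y = 1" for y
      using abs_Cesaro_sup_le[OF p _ that(1), of C] C that(2) by (auto simp: le_less_trans)
    then show "Np p (Lp M p) (Lp_norm M p) (wcomp M p w f) \<le> C"
      by (auto simp: Np_def intro!: SUP_least)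
  qed
next
  show "?S \<le> Np p (Lp M p) (Lp_norm M p) (wcomp M p w f)"
  proof (rule SUP_least)
    fix B assume "B \<in> {B \<in> sets M. 0 < emeasure M B \<and> emeasure M B < \<infinity>}"
    then have B: "B \<in> sets M" "0 < emeasure M B" "emeasure M B < \<infinity>" by auto
    define m where "m = measure M B"
    have em: "emeasure M B = ennreal m"
      using B by (simp add: m_def emeasure_eq_ennreal_measure)
    have m: "0 < m" using B(2) by (simp add: em)
    \<comment> \<open>Chosen so that the scaled indicator of \<open>B\<close> has norm one, since
      the power \<open>p\<close> of its norm is \<open>\<bar>r\<bar> powr p * m\<close>.\<close>
    define r where "r = (1 / m) powr (1 / p)"
    have r: "\<bar>r\<bar> powr p = 1 / m" using m p by (simp add: r_def powr_powr)
    define y :: "('a \<Rightarrow> 'k) set" where "y = Lp_eq M p `` {\<lambda>x. of_real r * indicator B x}"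
    have powr_1: "Lp_norm M p y powr p = 1"
      using B m p by (simp add: y_def Lp_norm_scaled_indicator r m_def[symmetric])
    have "0 \<le> Lp_norm M p y"
      using B by (simp add: y_def Lp_norm_class scaled_indicator_in_Lp_funs Lp_seminorm_def)
    then have "Lp_norm M p y = (Lp_norm M p y powr p) powr (1 / p)"
      using p by (simp add: powr_powr)
    then have "Lp_norm M p y = 1" by (simp add: powr_1)
    moreover have "y \<in> Lp M p" using B by (simp add: y_def scaled_indicator_in_Lp)
    ultimately have "abs_Cesaro_sup p (Lp_norm M p) (wcomp M p w f) y
        \<le> Np p (Lp M p) (Lp_norm M p) (wcomp M p w f)"
      by (auto simp: Np_def intro: SUP_upper)
    \<comment> \<open>The factor \<open>\<bar>r\<bar> powr p\<close> in front of each term thus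
      becomes the division by the measure of \<open>B\<close>.\<close>
    moreover have "ennreal (1 / m) * t = t / emeasure M B" for t
      using m by (simp add: em divide_ennreal_def inverse_ennreal mult.commute inverse_eq_divide)
    ultimately show "(SUP N\<in>{1::nat..}. 1 / of_nat N *
        (\<Sum>n=1..N. emeasure (orbit_measure M p w f n) B / emeasure M B))
        \<le> Np p (Lp M p) (Lp_norm M p) (wcomp M p w f)"
      using B p by (simp add: y_def abs_Cesaro_sup_scaled_indicator r)
  qed
qed

text \<open>The same constant serves in both directions: indicators give the bound on sets, and
  \<open>abs_Cesaro_sup_le\<close> gives it back for all classes.\<close>

lemma abs_Cesaro_bounded_wcomp:
  assumes p: "1 \<le> p"
  shows "abs_Cesaro_bounded p (Lp M p) (Lp_norm M p) (wcomp M p w f) \<longleftrightarrow>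
    (\<exists>C::real. 0 < C \<and>
       (\<forall>B\<in>sets M. 0 < emeasure M B \<and> emeasure M B < \<infinity> \<longrightarrow>
          (\<forall>N::nat. 1 \<le> N \<longrightarrow>
             1 / of_nat N * (\<Sum>n=1..N. emeasure (orbit_measure M p w f n) B)
               \<le> ennreal C * emeasure M B)))"
    (is "?L \<longleftrightarrow> (\<exists>C. 0 < C \<and> ?R C)")
proof
  assume ?L
  then obtain C where C: "0 < C" and le: "\<And>y. y \<in> Lp M p \<Longrightarrow>
      abs_Cesaro_sup p (Lp_norm M p) (wcomp M p w f) y \<le> ennreal (C * Lp_norm M p y powr p)"
    by (auto simp: abs_Cesaro_bounded_def)
  have "?R C"
  proof (intro ballI impI allI)
    fix B and N :: nat
    assume B: "B \<in> sets M" "0 < emeasure M B \<and> emeasure M B < \<infinity>" and N: "1 \<le> N"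
    let ?y = "Lp_eq M p `` {\<lambda>x. of_real 1 * indicator B x :: 'k}"
    have "1 / of_nat N * (\<Sum>n=1..N. emeasure (orbit_measure M p w f n) B)
        \<le> abs_Cesaro_sup p (Lp_norm M p) (wcomp M p w f) ?y"
      using B N p by (subst abs_Cesaro_sup_scaled_indicator) (auto intro!: SUP_upper2[of N])
    also have "\<dots> \<le> ennreal (C * Lp_norm M p ?y powr p)"
      using B by (intro le scaled_indicator_in_Lp) auto
    also have "\<dots> = ennreal (C * measure M B)"
      using B p by (subst Lp_norm_scaled_indicator) auto
    also have "\<dots> = ennreal C * emeasure M B"
      using B C by (subst emeasure_eq_ennreal_measure) (auto simp: ennreal_mult)
    finally show "1 / of_nat N * (\<Sum>n=1..N. emeasure (orbit_measure M p w f n) B)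
        \<le> ennreal C * emeasure M B" .
  qed
  with C show "\<exists>C. 0 < C \<and> ?R C" by blast
next
  assume "\<exists>C. 0 < C \<and> ?R C"
  then obtain C where C: "0 < C" "?R C" by blast
  then have "abs_Cesaro_sup p (Lp_norm M p) (wcomp M p w f) y
      \<le> ennreal (C * Lp_norm M p y powr p)" if "y \<in> Lp M p" for y
    using abs_Cesaro_sup_le[OF p _ that, of "ennreal C"] by (simp add: ennreal_mult)
  with C(1) show ?L by (auto simp: abs_Cesaro_bounded_def)
qed

end

theorem theorem56:
  fixes M :: "'a measure" and p :: real
    and w :: "'a \<Rightarrow> 'k::{real_normed_field, euclidean_space}" and f :: "'a \<Rightarrow> 'a"
  assumes "1 \<le> p" and "wcomp_data M p w f"
  shows "(Np p (Lp M p) (Lp_norm M p) (wcomp M p w f) =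
      (SUP B\<in>{B \<in> sets M. 0 < emeasure M B \<and> emeasure M B < \<infinity>}. SUP N\<in>{1::nat..}.
         1 / of_nat N *
         (\<Sum>n=1..N. iter_measure M p w f n ((f ^^ n) -` B \<inter> space M) / emeasure M B)))
    \<and> (abs_Cesaro_bounded p (Lp M p) (Lp_norm M p) (wcomp M p w f) \<longleftrightarrow>
      (\<exists>C::real. 0 < C \<and>
         (\<forall>B\<in>sets M. 0 < emeasure M B \<and> emeasure M B < \<infinity> \<longrightarrow>
            (\<forall>N::nat. 1 \<le> N \<longrightarrow>
               1 / of_nat N * (\<Sum>n=1..N. iter_measure M p w f n ((f ^^ n) -` B \<inter> space M))
                 \<le> ennreal C * emeasure M B))))"
proof -
  interpret weighted_composition M p w f by unfold_locales (rule assms(2))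
  have eq: "iter_measure M p w f n ((f ^^ n) -` B \<inter> space M) = emeasure (orbit_measure M p w f n) B"
    if "B \<in> sets M" for B n
    using emeasure_orbit_measure[OF that] by simp
  show ?thesis
    unfolding Np_wcomp[OF assms(1)] abs_Cesaro_bounded_wcomp[OF assms(1)]
  \<comment> \<open>The equation \<open>eq\<close> needs \<open>B\<close> measurable, so both cases
    go under the binders with congruence rules that supply membership of \<open>B\<close>.\<close>
  proof (rule conjI, goal_cases)
    case 1
    show ?case by (intro SUP_cong refl) (simp add: eq)
  next
    case 2
    show ?case by (intro ex_cong1 conj_cong ball_cong refl) (simp add: eq)
  qed
qed

end
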